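(* Let $L:\mathsf{T}(\mathsf{S}^2)^n\to\mathbb{R}$ be a Lagrangian and $\tilde L(q,\omega)=L(q,S(\omega)q)$ the modified Lagrangian, where $S(\omega)q=(S(\omega_1)q_1,\dots,S(\omega_n)q_n)$. Assume the Legendre transformation $\omega\mapsto\pi$, $\pi_i=(I_3-q_iq_i^T)\frac{\partial\tilde L(q,\omega)}{\partial\omega_i}$, $i=1,\dots,n$, is invertible (from $\{\omega:\omega_i\cdot q_i=0\}$ onto $\{\pi:\pi_i\cdot q_i=0\}$), and let $\tilde H(q,\pi)=\sum_{j=1}^n\pi_j\cdot\omega_j-\tilde L(q,\omega)$ be the modified Hamiltonian, with the right-hand side expressed in terms of $(q,\pi)$ through the Legendre transformation. Let $f_i\in\mathbb{R}^3$ be the generalized force acting on $q_i$. Hamilton's equations for $\tilde H$ are $$\dot q_i=-S(q_i)\frac{\partial\tilde H(q,\pi)}{\partial\pi_i},$$ $$\dot\pi_i=-S(q_i)\frac{\partial\tilde H(q,\pi)}{\partial q_i}+\frac{\partial\tilde H(q,\pi)}{\partial\pi_i}\times\pi_i+S(q_i)f_i,$$ for $i=1,\dots,n$. That is, a curve $(q,\pi)$ on $[t_0,t_f]$ with $q_i\in\mathsf{S}^2$ and $\pi_i\cdot q_i=0$ satisfies Hamilton's phase space variational principle $\delta\tilde{\mathfrak{G}}=-\delta\mathcal{W}$ for all admissible variations if and only if these equations hold along it.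
   Context: $\mathsf{S}^2=\{q\in\mathbb{R}^3:\|q\|=1\}$, $\mathsf{T}_q\mathsf{S}^2=\{\xi\in\mathbb{R}^3: q\cdot\xi=0\}$, $I_3$ is the $3\times3$ identity matrix, and $S(x)$ is the skew-symmetric $3\times3$ matrix with $S(x)y=x\times y$. For a curve $q_i$ in $\mathsf{S}^2$ the angular velocity is $\omega_i=S(q_i)\dot q_i$; it satisfies $\omega_i\cdot q_i=0$ and $\dot q_i=S(\omega_i)q_i$. All functions and curves are assumed sufficiently smooth. $\tilde L$ and $\tilde H$ are regarded as (restrictions of) smooth functions on an open neighborhood in $\mathbb{R}^{3n}\times\mathbb{R}^{3n}$, and $\partial\tilde L/\partial\omega_i$, $\partial\tilde H/\partial q_i$, $\partial\tilde H/\partial\pi_i\in\mathbb{R}^3$ are the ordinary gradients there ($q$ and $\pi$, respectively $q$ and $\omega$, treated as independent arguments). The modified action is $\tilde{\mathfrak{G}}=\int_{t_0}^{t_f}\left\{\sum_{j=1}^n\pi_j\cdot\omega_j-\tilde H(q,\pi)\right\}dt$ with $\omega_j=S(q_j)\dot q_j$, and $\delta\tilde{\mathfrak{G}}$ is its first variation. Admissible variations: $\delta q_i=S(\gamma_i)q_i$ with $\gamma_i:[t_0,t_f]\to\mathbb{R}^3$ continuously differentiable, $\gamma_i(t_0)=\gamma_i(t_f)=0$, $\gamma_i\cdot q_i=0$; the induced variation of $\omega_i$ is $\delta\omega_i=-S(\omega_i)\gamma_i+(I_3-q_iq_i^T)\dot\gamma_i$; and $\delta\pi_i:[t_0,t_f]\to\mathbb{R}^3$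 is subject only to $\delta q_i\cdot\pi_i+q_i\cdot\delta\pi_i=0$ (the linearization of $q_i\cdot\pi_i=0$). The virtual work of the generalized forces (given continuous $\mathbb{R}^3$-valued functions along the motion) is $\sum_i f_i\cdot\delta q_i$, and $\delta\mathcal{W}=\int_{t_0}^{t_f}\sum_{i=1}^n f_i\cdot\delta q_i\,dt$. Hamilton's equations are the equations characterizing the curves $(q,\pi)$ (with $q_i\in\mathsf{S}^2$, $\pi_i\cdot q_i=0$) satisfying $\delta\tilde{\mathfrak{G}}=-\delta\mathcal{W}$ for all admissible variations. *)

theory Defs
  imports "HOL-Analysis.Analysis"
begin

unbundle cross3_syntax

text \<open>
  Points of \<open>(\<real>\<^sup>3)\<^sup>n\<close> are elements of \<^typ>\<open>real^3^'n\<close>, where \<open>n = CARD('n)\<close>; the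
  matrix \<open>S(x)\<close> acts as \<open>y \<mapsto> x \<times> y\<close>, with \<open>\<times>\<close> the cross product.
\<close>

definition config :: "(real^3^'n) set" where
  "config = {q. \<forall>i. q $ i \<in> sphere 0 1}"

definition tangent :: "real^3^'n \<Rightarrow> (real^3^'n) set" where
  "tangent q = {w. \<forall>i. w $ i \<bullet> q $ i = 0}"

text \<open>
  \<open>T(S\<^sup>2)\<^sup>n\<close>, which serves as the domain of the velocity pairs \<open>(q, q')\<close> as well as of
  the pairs \<open>(q, \<omega>)\<close> and \<open>(q, \<pi>)\<close>, since \<open>\<omega>\<^sub>i\<close> and \<open>\<pi>\<^sub>i\<close> are also orthogonal to \<open>q\<^sub>i\<close>.
\<close>

definition TS2 :: "((real^3^'n) \<times> (real^3^'n)) set" where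
  "TS2 = Sigma config tangent"

definition gradient :: "('a::real_inner \<Rightarrow> real) \<Rightarrow> 'a \<Rightarrow> 'a" where
  "gradient F x = (THE g. GDERIV F x :> g)"

lemma gradient_eq:
  assumes "GDERIV F x :> g"
  shows "gradient F x = g"
  unfolding gradient_def
proof (rule the_equality)
  fix g' assume "GDERIV F x :> g'"
  with assms have "(\<lambda>h. h \<bullet> g') = (\<lambda>h. h \<bullet> g)"
    unfolding gderiv_def by (metis has_derivative_unique)
  then show "g' = g"
    by (metis inner_commute vector_eq_rdot)
qed (fact assms)

text \<open>
  The inner product of \<^typ>\<open>real^3^'n\<close> is the sum of the inner products of the components, so
  component \<open>i\<close> of these gradients is the gradient in \<open>\<real>\<^sup>3\<close> with respect to the \<open>i\<close>-th vector.
\<close>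

definition grad1 :: "('a::real_inner \<times> 'b::real_inner \<Rightarrow> real) \<Rightarrow> 'a \<Rightarrow> 'b \<Rightarrow> 'a" where
  "grad1 F x y = gradient (\<lambda>u. F (u, y)) x"

definition grad2 :: "('a::real_inner \<times> 'b::real_inner \<Rightarrow> real) \<Rightarrow> 'a \<Rightarrow> 'b \<Rightarrow> 'b" where
  "grad2 F x y = gradient (\<lambda>v. F (x, v)) y"

text \<open>
  ``Sufficiently smooth'' is read as continuously differentiable: for functions on some open
  neighbourhood of the given set, for curves on the closed interval (one-sided at the ends).
\<close>

definition C1_near :: "'a::real_inner set \<Rightarrow> ('a \<Rightarrow> real) \<Rightarrow> bool" where
  "C1_near A F \<longleftrightarrow>
     (\<exists>U G. open U \<and> A \<subseteq> U \<and> continuous_on U G \<and> (\<forall>x\<in>U. GDERIV F x :> G x))"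

definition C1_curve :: "real \<Rightarrow> real \<Rightarrow> (real \<Rightarrow> 'a::real_normed_vector) \<Rightarrow> bool" where
  "C1_curve t0 tf x \<longleftrightarrow>
     (\<exists>x'. continuous_on {t0..tf} x' \<and>
        (\<forall>t\<in>{t0..tf}. (x has_vector_derivative x' t) (at t within {t0..tf})))"

text \<open>\<open>(I - a a\<^sup>T) v\<close>\<close>

definition proj :: "real^3 \<Rightarrow> real^3 \<Rightarrow> real^3" where
  "proj a v = v - (a \<bullet> v) *\<^sub>R a"

definition legendre ::
  "((real^3^'n) \<times> (real^3^'n) \<Rightarrow> real) \<Rightarrow> real^3^'n \<Rightarrow> real^3^'n \<Rightarrow> real^3^'n" where
  "legendre Lt q \<omega> = (\<chi> i. proj (q $ i) (grad2 Lt q \<omega> $ i))"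

definition hamiltonian ::
  "((real^3^'n) \<times> (real^3^'n) \<Rightarrow> real) \<Rightarrow> real^3^'n \<Rightarrow> real^3^'n \<Rightarrow> real" where
  "hamiltonian Lt q \<pi> =
     (let \<omega> = the_inv_into (tangent q) (legendre Lt q) \<pi>
      in (\<Sum>j\<in>UNIV. \<pi> $ j \<bullet> \<omega> $ j) - Lt (q, \<omega>))"

definition angular_velocity ::
  "real \<Rightarrow> real \<Rightarrow> (real \<Rightarrow> real^3^'n) \<Rightarrow> real \<Rightarrow> real^3^'n" where
  "angular_velocity t0 tf q t =
     (\<chi> i. q t $ i \<times> vector_derivative q (at t within {t0..tf}) $ i)"

definition action ::
  "((real^3^'n) \<times> (real^3^'n) \<Rightarrow> real) \<Rightarrow> real \<Rightarrow> real \<Rightarrow>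
   (real \<Rightarrow> real^3^'n) \<Rightarrow> (real \<Rightarrow> real^3^'n) \<Rightarrow> real" where
  "action H t0 tf q \<pi> =
     integral {t0..tf}
       (\<lambda>t. (\<Sum>j\<in>UNIV. \<pi> t $ j \<bullet> angular_velocity t0 tf q t $ j) - H (q t, \<pi> t))"

text \<open>
  The first variation is the directional derivative of the action.  The straight lines
  \<open>q + \<epsilon> \<delta>q\<close>, \<open>\<pi> + \<epsilon> \<delta>\<pi>\<close> leave \<open>T(S\<^sup>2)\<^sup>n\<close>, but remain, for small \<open>\<epsilon>\<close>, in the open
  neighbourhood on which \<open>H\<close> is defined; to first order they agree with any variation inside
  \<open>T(S\<^sup>2)\<^sup>n\<close> with the same \<open>\<delta>q\<close>, \<open>\<delta>\<pi>\<close>.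
\<close>

definition has_first_variation ::
  "((real^3^'n) \<times> (real^3^'n) \<Rightarrow> real) \<Rightarrow> real \<Rightarrow> real \<Rightarrow>
   (real \<Rightarrow> real^3^'n) \<Rightarrow> (real \<Rightarrow> real^3^'n) \<Rightarrow>
   (real \<Rightarrow> real^3^'n) \<Rightarrow> (real \<Rightarrow> real^3^'n) \<Rightarrow> real \<Rightarrow> bool" where
  "has_first_variation H t0 tf q \<pi> \<delta>q \<delta>\<pi> D \<longleftrightarrow>
     ((\<lambda>\<epsilon>. action H t0 tf (\<lambda>t. q t + \<epsilon> *\<^sub>R \<delta>q t) (\<lambda>t. \<pi> t + \<epsilon> *\<^sub>R \<delta>\<pi> t))
        has_real_derivative D) (at 0)"

definition admissible_variation ::
  "real \<Rightarrow> real \<Rightarrow> (real \<Rightarrow> real^3^'n) \<Rightarrow> (real \<Rightarrow> real^3^'n) \<Rightarrow>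
   (real \<Rightarrow> real^3^'n) \<Rightarrow> (real \<Rightarrow> real^3^'n) \<Rightarrow> bool" where
  "admissible_variation t0 tf q \<pi> \<delta>q \<delta>\<pi> \<longleftrightarrow>
     (\<exists>\<gamma>. C1_curve t0 tf \<gamma> \<and> \<gamma> t0 = 0 \<and> \<gamma> tf = 0 \<and>
        (\<forall>t\<in>{t0..tf}. \<forall>i. \<gamma> t $ i \<bullet> q t $ i = 0 \<and> \<delta>q t $ i = \<gamma> t $ i \<times> q t $ i)) \<and>
     continuous_on {t0..tf} \<delta>\<pi> \<and>
     (\<forall>t\<in>{t0..tf}. \<forall>i. \<delta>q t $ i \<bullet> \<pi> t $ i + q t $ i \<bullet> \<delta>\<pi> t $ i = 0)"

lemma cross_angular_identity:
  fixes a q w c :: "real^3"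
  assumes "norm q = 1"
  shows "(a \<times> q) \<times> w + q \<times> (c \<times> q + a \<times> w) = - ((q \<times> w) \<times> a) + proj q c"
proof -
  have 1: "q \<times> (c \<times> q) = proj q c"
    using assms by (simp add: Lagrange proj_def dot_square_norm)
  have 2: "(a \<times> q) \<times> w + q \<times> (a \<times> w) = - ((q \<times> w) \<times> a)"
    by (simp add: cross3_simps forall_3)
  show ?thesis
    using 1 2 by (simp add: cross_add_right algebra_simps)
qed

lemma bounded_bilinear_componentwise_cross:
  "bounded_bilinear (\<lambda>a b :: real^3^'n. \<chi> i. a $ i \<times> b $ i)"
  unfolding bilinear_conv_bounded_bilinear[symmetric]
  by (auto simp: bilinear_def linear_iff vec_eq_iff cross_add_left cross_add_right
      cross_mult_left cross_mult_right)

text \<open>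
  The variation of the angular velocity induced by \<open>\<delta>q = S(\<gamma>) q\<close> is
  \<open>\<delta>\<omega> = - S(\<omega>) \<gamma> + (I - q q\<^sup>T) \<gamma>'\<close>.
\<close>

lemma induced_variation_angular_velocity:
  fixes q \<gamma> :: "real \<Rightarrow> real^3^'n"
  assumes "t0 < tf" and t: "t \<in> {t0..tf}" and "q t \<in> config"
    and q': "(q has_vector_derivative q') (at t within {t0..tf})"
    and \<gamma>': "(\<gamma> has_vector_derivative \<gamma>') (at t within {t0..tf})"
    and \<delta>q: "\<And>s. s \<in> {t0..tf} \<Longrightarrow> \<delta>q s = (\<chi> i. \<gamma> s $ i \<times> q s $ i)"
  shows "((\<lambda>\<epsilon>. angular_velocity t0 tf (\<lambda>s. q s + \<epsilon> *\<^sub>R \<delta>q s) t $ i) has_vector_derivative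
           - (angular_velocity t0 tf q t $ i \<times> \<gamma> t $ i) + proj (q t $ i) (\<gamma>' $ i)) (at 0)"
proof -
  have nb: "at t within {t0..tf} \<noteq> bot"
    using assms(1) t by (simp add: trivial_limit_within islimpt_Icc)
  define d where "d = (\<chi> i. \<gamma>' $ i \<times> q t $ i + \<gamma> t $ i \<times> q' $ i)"
  have "((\<lambda>s. \<chi> i. \<gamma> s $ i \<times> q s $ i) has_vector_derivative d) (at t within {t0..tf})"
    using bounded_bilinear.has_vector_derivative[OF bounded_bilinear_componentwise_cross \<gamma>' q']
    by (rule has_vector_derivative_eq_rhs) (simp add: d_def vec_eq_iff)
  then have d: "(\<delta>q has_vector_derivative d) (at t within {t0..tf})"
    by (rule has_vector_derivative_transform[OF t, rotated]) (simp add: \<delta>q)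
  have v: "vector_derivative (\<lambda>s. q s + \<epsilon> *\<^sub>R \<delta>q s) (at t within {t0..tf}) = q' + \<epsilon> *\<^sub>R d" for \<epsilon>
    by (intro vector_derivative_within nb) (auto intro!: derivative_eq_intros q' d)
  have q0: "vector_derivative q (at t within {t0..tf}) = q'"
    by (intro vector_derivative_within nb q')
  have n: "norm (q t $ i) = 1"
    using assms(3) by (simp add: config_def)
  have cross: "bounded_bilinear ((\<times>) :: real^3 \<Rightarrow> _)"
    using bilinear_cross by (simp add: bilinear_conv_bounded_bilinear)
  have a: "((\<lambda>\<epsilon>. q t $ i + \<epsilon> *\<^sub>R \<delta>q t $ i) has_vector_derivative \<delta>q t $ i) (at 0)"
    and b: "((\<lambda>\<epsilon>. q' $ i + \<epsilon> *\<^sub>R d $ i) has_vector_derivative d $ i) (at 0)"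
    by (auto intro!: derivative_eq_intros)
  show ?thesis
    unfolding angular_velocity_def v q0 vec_lambda_beta
    using bounded_bilinear.has_vector_derivative[OF cross a b]
      cross_angular_identity[OF n, of "\<gamma> t $ i" "q' $ i" "\<gamma>' $ i"]
    by (simp add: \<delta>q[OF t] d_def add.commute)
qed

definition virtual_work ::
  "real \<Rightarrow> real \<Rightarrow> (real \<Rightarrow> real^3^'n) \<Rightarrow> (real \<Rightarrow> real^3^'n) \<Rightarrow> real" where
  "virtual_work t0 tf f \<delta>q = integral {t0..tf} (\<lambda>t. \<Sum>i\<in>UNIV. f t $ i \<bullet> \<delta>q t $ i)"

definition hamilton_principle ::
  "((real^3^'n) \<times> (real^3^'n) \<Rightarrow> real) \<Rightarrow> (real \<Rightarrow> real^3^'n) \<Rightarrow> real \<Rightarrow> real \<Rightarrow>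
   (real \<Rightarrow> real^3^'n) \<Rightarrow> (real \<Rightarrow> real^3^'n) \<Rightarrow> bool" where
  "hamilton_principle H f t0 tf q \<pi> \<longleftrightarrow>
     (\<forall>\<delta>q \<delta>\<pi>. admissible_variation t0 tf q \<pi> \<delta>q \<delta>\<pi> \<longrightarrow>
        has_first_variation H t0 tf q \<pi> \<delta>q \<delta>\<pi> (- virtual_work t0 tf f \<delta>q))"

end

theory Submission
  imports Defs
begin

text \<open>
  Write \<open>\<omega> = q \<times> q'\<close>, \<open>Q = \<partial>H/\<partial>q\<close>, \<open>P = \<partial>H/\<partial>\<pi>\<close>, suppressing the index of the factor, and call
  \<open>e = q' + q \<times> P\<close> and \<open>r = \<pi>' - (- q \<times> Q + P \<times> \<pi> + q \<times> f)\<close> the defects of the two Hamilton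
  equations.  The theorem rests on the identity
  \<open>\<delta>G + \<delta>W = \<integral> (q \<times> e) \<bullet> (\<delta>\<pi> + \<pi> \<times> \<gamma>) - r \<bullet> \<gamma> dt\<close>,
  valid for every admissible variation (\<open>first_variation_eq_defects\<close>).

  To obtain it, differentiate the action under the integral sign
  (\<open>action_has_first_variation\<close>) and insert \<open>\<delta>\<omega> = - \<omega> \<times> \<gamma> + (I - q q\<^sup>T) \<gamma>'\<close>.  As \<open>\<pi>\<close> is
  orthogonal to \<open>q\<close>, the projection drops out of \<open>\<pi> \<bullet> \<delta>\<omega>\<close>, and integrating \<open>\<pi> \<bullet> \<gamma>'\<close> by parts
  leaves the integrand
  \<open>(\<omega> - P) \<bullet> \<delta>\<pi> + (- \<pi>' + \<omega> \<times> \<pi> - q \<times> Q + q \<times> f) \<bullet> \<gamma>\<close>.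
  Here \<open>\<delta>\<pi>\<close> and \<open>\<gamma>\<close> are not independent: the linearized constraint ties the component of \<open>\<delta>\<pi>\<close>
  along \<open>q\<close> to \<open>\<gamma>\<close>.  It says precisely that \<open>\<delta>\<pi> + \<pi> \<times> \<gamma>\<close> is tangential, and rewriting the
  integrand in terms of this combination turns \<open>\<omega> \<times> \<pi>\<close> into \<open>P \<times> \<pi>\<close>, while only the tangential
  part \<open>q \<times> e\<close> of \<open>\<omega> - P\<close> remains.

  Thus vanishing defects give the variational principle.  Conversely, \<open>\<gamma> = 0\<close> and
  \<open>\<delta>\<pi> = q \<times> e\<close> make the integrand a square, hence \<open>q \<times> e = 0\<close>, and \<open>e = 0\<close> because \<open>e\<close> is
  tangential (\<open>principle_imp_q_defect_zero\<close>).  Then arbitrary tangential \<open>\<gamma>\<close>, compensated by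
  a multiple of \<open>q\<close> in \<open>\<delta>\<pi>\<close>, and the fundamental lemma of the calculus of variations show that
  the tangential part of \<open>r\<close> vanishes (\<open>principle_imp_p_defect_zero\<close>).  The normal part is zero
  anyway: by \<open>e = 0\<close>, it is the time derivative of the constraint \<open>\<pi> \<bullet> q = 0\<close>
  (\<open>p_defect_perp\<close>).
\<close>

section \<open>The fundamental lemma of the calculus of variations\<close>

lemma has_real_derivative_max_0_squared:
  "((\<lambda>x::real. (max 0 x)\<^sup>2) has_real_derivative 2 * max 0 x) (at x)"
proof (cases "x = 0")
  case True
  have "((\<lambda>h::real. (max 0 h)\<^sup>2 / h) \<longlongrightarrow> 0) (at 0)"
  proof (rule tendsto_0_le[where K = 1 and f = "\<lambda>h::real. h"])
    show "\<forall>\<^sub>F h::real in at 0. norm ((max 0 h)\<^sup>2 / h) \<le> norm h * 1"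
      by (intro always_eventually) (auto simp: max_def power2_eq_square)
  qed (rule tendsto_ident_at)
  then show ?thesis
    using True by (simp add: DERIV_def)
next
  case False
  then consider "x < 0" | "x > 0" by linarith
  then show ?thesis
  proof cases
    case 1
    have "((\<lambda>x::real. 0) has_real_derivative 2 * max 0 x) (at x)"
      using 1 by simp
    then show ?thesis
      by (rule has_field_derivative_transform_within_open[where S = "{..<0}"]) (use 1 in auto)
  next
    case 2
    have "((\<lambda>x::real. x\<^sup>2) has_real_derivative 2 * max 0 x) (at x)"
      using 2 by (auto intro!: derivative_eq_intros)
    then show ?thesis
      by (rule has_field_derivative_transform_within_open[where S = "{0<..}"]) (use 2 in auto)
  qed
qed

text \<open>
  The square of a parabola cut off at zero: squaring makes the cut-off continuously
  differentiable, which is all the smoothness that test functions need here.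
\<close>

lemma bump_function:
  fixes s d :: real
  assumes "d > 0"
  obtains \<phi> \<phi>' :: "real \<Rightarrow> real"
  where "\<And>t. (\<phi> has_real_derivative \<phi>' t) (at t)" "continuous_on UNIV \<phi>'"
    and "\<And>t. \<phi> t \<ge> 0" "\<And>t. \<phi> t > 0 \<longleftrightarrow> \<bar>t - s\<bar> < d"
proof
  let ?\<phi> = "\<lambda>t. (max 0 (d\<^sup>2 - (t - s)\<^sup>2))\<^sup>2"
  let ?\<phi>' = "\<lambda>t. 2 * max 0 (d\<^sup>2 - (t - s)\<^sup>2) * (- (2 * (t - s)))"
  show "(?\<phi> has_real_derivative ?\<phi>' t) (at t)" for t
    by (rule DERIV_chain2[OF has_real_derivative_max_0_squared])
      (auto intro!: derivative_eq_intros)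
  show "continuous_on UNIV ?\<phi>'"
    by (intro continuous_intros)
  show "?\<phi> t \<ge> 0" for t
    by simp
  show "?\<phi> t > 0 \<longleftrightarrow> \<bar>t - s\<bar> < d" for t
    using assms abs_le_square_iff[of d "t - s"] by (auto simp: max_def)
qed

text \<open>
  If \<open>g s \<noteq> 0\<close> at an interior point, then \<open>g\<close> keeps its sign near \<open>s\<close>, and a bump supported
  there has a nonzero integral against \<open>g\<close>.  The endpoints, where test functions vanish,
  follow by continuity.
\<close>

lemma fundamental_lemma_calculus_of_variations:
  fixes g :: "real \<Rightarrow> real"
  assumes "a < b" and g: "continuous_on {a..b} g"
    and orth: "\<And>\<phi> \<phi>'. (\<And>t. (\<phi> has_real_derivative \<phi>' t) (at t)) \<Longrightarrow>
      continuous_on UNIV \<phi>' \<Longrightarrow> \<phi> a = 0 \<Longrightarrow> \<phi> b = 0 \<Longrightarrow>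
      integral {a..b} (\<lambda>t. \<phi> t * g t) = 0"
    and "t \<in> {a..b}"
  shows "g t = 0"
proof -
  have interior: "g s = 0" if s: "s \<in> {a<..<b}" for s
  proof (rule ccontr)
    assume "g s \<noteq> 0"
    have "isCont g s"
      using continuous_on_interior[OF g, of s] s by simp
    then have "isCont (\<lambda>t. g t * g s) s"
      by (intro continuous_intros)
    then have "\<forall>\<^sub>F t in at s. 0 < g t * g s"
      unfolding isCont_def by (rule order_tendstoD) (use \<open>g s \<noteq> 0\<close> in \<open>simp flip: power2_eq_square\<close>)
    then obtain d0 where "d0 > 0" and "\<And>t. t \<noteq> s \<Longrightarrow> dist t s < d0 \<Longrightarrow> 0 < g t * g s"
      unfolding eventually_at by blast
    then have pos: "0 < g t * g s" if "\<bar>t - s\<bar> < d0" for t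
      using \<open>g s \<noteq> 0\<close> that by (cases "t = s") (auto simp: dist_real_def simp flip: power2_eq_square)
    \<comment> \<open>The last two bounds make the bump vanish at \<open>a\<close> and \<open>b\<close>.\<close>
    define d where "d = min d0 (min (s - a) (b - s))"
    have "d > 0"
      using s \<open>d0 > 0\<close> by (simp add: d_def)
    from bump_function[OF this, of s] obtain \<phi> \<phi>' :: "real \<Rightarrow> real"
      where \<phi>: "\<And>t. (\<phi> has_real_derivative \<phi>' t) (at t)" "continuous_on UNIV \<phi>'"
        and \<phi>_ge: "\<And>t. \<phi> t \<ge> 0" and \<phi>_pos: "\<And>t. \<phi> t > 0 \<longleftrightarrow> \<bar>t - s\<bar> < d"
      by blast
    have "\<phi> a = 0" "\<phi> b = 0"
      using \<phi>_ge[of a] \<phi>_pos[of a] \<phi>_ge[of b] \<phi>_pos[of b] s by (auto simp: d_def)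
    then have "integral {a..b} (\<lambda>t. \<phi> t * g t) = 0"
      by (rule orth[OF \<phi>])
    then have "integral {a..b} (\<lambda>t. (\<phi> t * g t) * g s) = 0"
      by simp
    moreover have "continuous_on {a..b} (\<lambda>t. (\<phi> t * g t) * g s)"
      using \<phi>(1) by (intro continuous_intros g DERIV_continuous_on) (rule DERIV_subset, auto)
    moreover have "0 \<le> (\<phi> t * g t) * g s" for t
    proof (cases "\<phi> t = 0")
      case False
      then have "0 < g t * g s"
        using \<phi>_ge[of t] \<phi>_pos[of t] by (intro pos) (auto simp: d_def)
      then show ?thesis
        using \<phi>_ge[of t] by (simp add: mult.assoc)
    qed simp
    ultimately have "\<phi> s * g s * g s = 0"
      using s \<open>a < b\<close> by (subst (asm) integral_eq_0_iff) auto
    then show False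
      using \<open>g s \<noteq> 0\<close> \<phi>_pos[of s] \<open>d > 0\<close> by auto
  qed
  show ?thesis
  proof (rule continuous_constant_on_closure[where S = "{a<..<b}" and f = g])
    show "continuous_on (closure {a<..<b}) g" "t \<in> closure {a<..<b}"
      using \<open>a < b\<close> g \<open>t \<in> {a..b}\<close> by simp_all
  qed (rule interior)
qed

section \<open>Vector algebra in each factor\<close>

definition vcross :: "real^3^'n \<Rightarrow> real^3^'n \<Rightarrow> real^3^'n" (infixr "\<times>\<^sub>n" 70) where
  "a \<times>\<^sub>n b = (\<chi> i. a $ i \<times> b $ i)"

lemma vcross_nth [simp]: "(a \<times>\<^sub>n b) $ i = a $ i \<times> b $ i"
  by (simp add: vcross_def)

lemma bounded_bilinear_vcross: "bounded_bilinear (\<times>\<^sub>n)"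
  using bounded_bilinear_componentwise_cross unfolding vcross_def .

lemmas has_vector_derivative_vcross =
  bounded_bilinear.has_vector_derivative[OF bounded_bilinear_vcross]

lemmas continuous_on_vcross [continuous_intros] =
  bounded_bilinear.continuous_on[OF bounded_bilinear_vcross]

lemma vcross_zero [simp]: "a \<times>\<^sub>n 0 = 0" "0 \<times>\<^sub>n a = 0"
  by (simp_all add: vec_eq_iff)

lemma inner_eq_sum_components: "a \<bullet> b = (\<Sum>i\<in>UNIV. a $ i \<bullet> b $ i)"
  for a b :: "real^3^'n"
  by (simp add: inner_vec_def)

lemma cross_cross_unit:
  fixes q v :: "real^3"
  assumes "norm q = 1"
  shows "q \<times> (q \<times> v) = - proj q v"
  using assms by (simp add: Lagrange proj_def dot_square_norm)

text \<open>
  The pointwise form of the main identity.  The left-hand side is the variation of the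
  integrand of the action, with \<open>c\<close> for \<open>\<gamma>\<close> and \<open>d\<close> for \<open>\<delta>\<pi>\<close>; the first bracket on the right is
  the derivative of \<open>p \<bullet> c\<close>.  The constraint means that \<open>d + p \<times> c\<close> is orthogonal to \<open>q\<close>, so that
  in \<open>(q \<times> q' - P) \<bullet> d = (q \<times> q' - P) \<bullet> (d + p \<times> c) - (q \<times> q' - P) \<bullet> (p \<times> c)\<close> the first term
  sees only the tangential part \<open>q \<times> (q' + q \<times> P)\<close> of \<open>q \<times> q' - P\<close>.  In the second, the
  summand with \<open>q \<times> q'\<close> cancels the term \<open>- p \<bullet> ((q \<times> q') \<times> c)\<close> coming from the variation of
  the angular velocity, and the summand with \<open>P\<close> produces the term \<open>P \<times> p\<close> of the second
  Hamilton equation.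
\<close>

lemma variation_density_component:
  fixes q q' p p' c c' d P Q f :: "real^3"
  assumes "norm q = 1" "p \<bullet> q = 0" "(c \<times> q) \<bullet> p + q \<bullet> d = 0"
  shows "d \<bullet> (q \<times> q') + p \<bullet> ((c \<times> q) \<times> q' + q \<times> (c' \<times> q + c \<times> q')) - ((c \<times> q) \<bullet> Q + d \<bullet> P)
    = (p \<bullet> c' + p' \<bullet> c) + (q \<times> (q' + q \<times> P)) \<bullet> (d + p \<times> c)
      - (p' - (- (q \<times> Q) + P \<times> p + q \<times> f)) \<bullet> c - f \<bullet> (c \<times> q)"
proof -
  have "p \<bullet> ((c \<times> q) \<times> q' + q \<times> (c' \<times> q + c \<times> q')) = p \<bullet> c' - p \<bullet> ((q \<times> q') \<times> c)"
    using assms(2) by (simp add: cross_angular_identity[OF assms(1)] proj_def inner_diff_right)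
  moreover have "(q \<times> (q' + q \<times> P)) \<bullet> (d + p \<times> c)
      = (q \<times> q') \<bullet> d + (q \<times> q') \<bullet> (p \<times> c) - P \<bullet> d - P \<bullet> (p \<times> c) + (q \<bullet> P) * (q \<bullet> (d + p \<times> c))"
    by (simp add: cross_add_right cross_cross_unit[OF assms(1)] proj_def algebra_simps
        inner_simps)
  moreover have "q \<bullet> (d + p \<times> c) = 0"
    using assms(3) by (simp add: inner_add_right) (simp add: cross3_simps)
  moreover have "(q \<times> q') \<bullet> (p \<times> c) = - (p \<bullet> ((q \<times> q') \<times> c))" "P \<bullet> (p \<times> c) = (P \<times> p) \<bullet> c"
      "(c \<times> q) \<bullet> Q = (q \<times> Q) \<bullet> c" "f \<bullet> (c \<times> q) = (q \<times> f) \<bullet> c"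
    by (simp_all add: cross3_simps)
  ultimately show ?thesis
    by (simp add: inner_simps inner_commute)
qed

lemma variation_density:
  fixes q q' p p' c c' d P Q f :: "real^3^'n"
  assumes "(q, p) \<in> TS2" and "\<And>i. (c \<times>\<^sub>n q) $ i \<bullet> p $ i + q $ i \<bullet> d $ i = 0"
  shows "d \<bullet> (q \<times>\<^sub>n q') + p \<bullet> ((c \<times>\<^sub>n q) \<times>\<^sub>n q' + q \<times>\<^sub>n (c' \<times>\<^sub>n q + c \<times>\<^sub>n q'))
      - ((c \<times>\<^sub>n q) \<bullet> Q + d \<bullet> P)
    = (p \<bullet> c' + p' \<bullet> c) + (q \<times>\<^sub>n (q' + q \<times>\<^sub>n P)) \<bullet> (d + p \<times>\<^sub>n c)
      - (p' - (- (q \<times>\<^sub>n Q) + P \<times>\<^sub>n p + q \<times>\<^sub>n f)) \<bullet> c - f \<bullet> (c \<times>\<^sub>n q)"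
  unfolding inner_eq_sum_components sum.distrib[symmetric] sum_subtractf[symmetric]
proof (intro sum.cong refl, goal_cases)
  case (1 i)
  have "norm (q $ i) = 1" "p $ i \<bullet> q $ i = 0" "(c $ i \<times> q $ i) \<bullet> p $ i + q $ i \<bullet> d $ i = 0"
    using assms by (auto simp: TS2_def config_def tangent_def)
  from variation_density_component[OF this] show ?case
    by simp
qed

section \<open>The first variation of the action\<close>

lemma GDERIV_imp_grad:
  fixes F :: "'a::real_inner \<times> 'b::real_inner \<Rightarrow> real"
  assumes "GDERIV F (x, y) :> g"
  shows "grad1 F x y = fst g" "grad2 F x y = snd g"
proof -
  have F: "(F has_derivative (\<lambda>h. h \<bullet> g)) (at (x, y))"
    using assms by (simp add: gderiv_def)
  have "((\<lambda>u. F (u, y)) has_derivative (\<lambda>h. (h, 0) \<bullet> g)) (at x)"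
    by (rule has_derivative_compose[of "\<lambda>u. (u, y)", OF _ F]) (auto intro!: derivative_eq_intros)
  then show "grad1 F x y = fst g"
    unfolding grad1_def by (intro gradient_eq) (simp add: gderiv_def inner_prod_def)
  have "((\<lambda>v. F (x, v)) has_derivative (\<lambda>h. (0, h) \<bullet> g)) (at y)"
    by (rule has_derivative_compose[of "\<lambda>v. (x, v)", OF _ F]) (auto intro!: derivative_eq_intros)
  then show "grad2 F x y = snd g"
    unfolding grad2_def by (intro gradient_eq) (simp add: gderiv_def inner_prod_def)
qed

text \<open>
  The bound on \<open>\<epsilon>\<close> is uniform in \<open>t\<close>: by compactness, balls of one common radius around
  the points of \<open>x ` S\<close> lie in \<open>U\<close>, and \<open>dx\<close> is bounded.
\<close>

lemma compact_image_perturb_subset_open: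
  fixes x dx :: "real \<Rightarrow> 'a::real_normed_vector"
  assumes "compact S" "continuous_on S x" "continuous_on S dx" "open U" "x ` S \<subseteq> U"
  obtains e where "e > 0" "\<And>\<epsilon> t. \<bar>\<epsilon>\<bar> < e \<Longrightarrow> t \<in> S \<Longrightarrow> x t + \<epsilon> *\<^sub>R dx t \<in> U"
proof -
  have "compact (x ` S)" "bounded (dx ` S)"
    using assms by (simp_all add: compact_continuous_image compact_imp_bounded)
  obtain r where "r > 0" and r: "(\<Union>y\<in>x ` S. ball y r) \<subseteq> U"
    using compact_subset_open_imp_ball_epsilon_subset[OF \<open>compact (x ` S)\<close> assms(4,5)] .
  obtain B where "B > 0" and B: "\<And>t. t \<in> S \<Longrightarrow> norm (dx t) \<le> B"
    using \<open>bounded (dx ` S)\<close> by (auto simp: bounded_pos)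
  show ?thesis
  proof
    show "r / B > 0"
      using \<open>r > 0\<close> \<open>B > 0\<close> by simp
    fix \<epsilon> t assume \<epsilon>: "\<bar>\<epsilon>\<bar> < r / B" and t: "t \<in> S"
    have "\<bar>\<epsilon>\<bar> * norm (dx t) \<le> \<bar>\<epsilon>\<bar> * B"
      using B[OF t] by (intro mult_left_mono) auto
    also have "\<dots> < r"
      using \<epsilon> \<open>B > 0\<close> by (simp add: field_simps)
    finally have "x t + \<epsilon> *\<^sub>R dx t \<in> ball (x t) r"
      by (simp add: dist_norm)
    then show "x t + \<epsilon> *\<^sub>R dx t \<in> U"
      using r t by blast
  qed
qed

lemma action_eq_integral:
  fixes q p :: "real \<Rightarrow> real^3^'n"
  assumes "t0 < tf"
    and "\<And>t. t \<in> {t0..tf} \<Longrightarrow> (q has_vector_derivative q' t) (at t within {t0..tf})"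
  shows "action H t0 tf q p = integral {t0..tf} (\<lambda>t. p t \<bullet> (q t \<times>\<^sub>n q' t) - H (q t, p t))"
proof -
  have "vector_derivative q (at t within {t0..tf}) = q' t" if "t \<in> {t0..tf}" for t
    using assms that
    by (intro vector_derivative_within) (simp_all add: trivial_limit_within islimpt_Icc)
  then show ?thesis
    unfolding action_def
    by (intro integral_cong) (simp add: angular_velocity_def inner_vec_def)
qed

text \<open>
  Differentiation under the integral sign.  It is legitimate because the curve is compact: the
  perturbed curves stay in the domain \<open>U\<close> of the gradient for all \<open>\<epsilon>\<close> in an interval around \<open>0\<close>,
  on which the derivative of the integrand is jointly continuous in \<open>\<epsilon>\<close> and \<open>t\<close>.
\<close>

lemma action_has_first_variation:
  fixes q q' p dq dq' dp :: "real \<Rightarrow> real^3^'n"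
  assumes "t0 < tf" and U: "open U" and G: "continuous_on U G"
    and H: "\<And>x. x \<in> U \<Longrightarrow> GDERIV H x :> G x"
    and q: "\<And>t. t \<in> {t0..tf} \<Longrightarrow> (q has_vector_derivative q' t) (at t within {t0..tf})"
    and dq: "\<And>t. t \<in> {t0..tf} \<Longrightarrow> (dq has_vector_derivative dq' t) (at t within {t0..tf})"
    and cont: "continuous_on {t0..tf} q'" "continuous_on {t0..tf} dq'"
      "continuous_on {t0..tf} p" "continuous_on {t0..tf} dp"
    and in_U: "\<And>t. t \<in> {t0..tf} \<Longrightarrow> (q t, p t) \<in> U"
  shows "has_first_variation H t0 tf q p dq dp
    (integral {t0..tf} (\<lambda>t. dp t \<bullet> (q t \<times>\<^sub>n q' t) + p t \<bullet> (dq t \<times>\<^sub>n q' t + q t \<times>\<^sub>n dq' t)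
       - (dq t, dp t) \<bullet> G (q t, p t)))"
proof -
  have contq: "continuous_on {t0..tf} q" "continuous_on {t0..tf} dq"
    using q dq by (meson continuous_on_vector_derivative)+
  define x where "x t = (q t, p t)" for t
  define dx where "dx t = (dq t, dp t)" for t
  have contx: "continuous_on {t0..tf} x" "continuous_on {t0..tf} dx"
    unfolding x_def dx_def by (intro continuous_intros contq cont)+
  obtain e where "e > 0"
    and e: "\<And>\<epsilon> t. \<bar>\<epsilon>\<bar> < e \<Longrightarrow> t \<in> {t0..tf} \<Longrightarrow> x t + \<epsilon> *\<^sub>R dx t \<in> U"
    using compact_image_perturb_subset_open[OF compact_Icc contx U] in_U
    by (auto simp: x_def image_subset_iff)
  define J where "J = {-e<..<e}"
  have J: "x t + \<epsilon> *\<^sub>R dx t \<in> U" if "\<epsilon> \<in> J" "t \<in> {t0..tf}" for \<epsilon> t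
    using e that by (auto simp: J_def)
  define k where "k \<epsilon> t = (p t + \<epsilon> *\<^sub>R dp t) \<bullet> ((q t + \<epsilon> *\<^sub>R dq t) \<times>\<^sub>n (q' t + \<epsilon> *\<^sub>R dq' t))
      - H (x t + \<epsilon> *\<^sub>R dx t)" for \<epsilon> t
  define k' where "k' \<epsilon> t = dp t \<bullet> ((q t + \<epsilon> *\<^sub>R dq t) \<times>\<^sub>n (q' t + \<epsilon> *\<^sub>R dq' t))
      + (p t + \<epsilon> *\<^sub>R dp t) \<bullet> (dq t \<times>\<^sub>n (q' t + \<epsilon> *\<^sub>R dq' t) + (q t + \<epsilon> *\<^sub>R dq t) \<times>\<^sub>n dq' t)
      - dx t \<bullet> G (x t + \<epsilon> *\<^sub>R dx t)" for \<epsilon> t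
  have action: "action H t0 tf (\<lambda>t. q t + \<epsilon> *\<^sub>R dq t) (\<lambda>t. p t + \<epsilon> *\<^sub>R dp t)
      = integral {t0..tf} (k \<epsilon>)" for \<epsilon>
  proof -
    have "((\<lambda>t. q t + \<epsilon> *\<^sub>R dq t) has_vector_derivative q' t + \<epsilon> *\<^sub>R dq' t) (at t within {t0..tf})"
      if "t \<in> {t0..tf}" for t
      by (auto intro!: derivative_eq_intros q[OF that] dq[OF that])
    from action_eq_integral[OF \<open>t0 < tf\<close> this] show ?thesis
      by (simp add: k_def[abs_def] x_def dx_def)
  qed
  have k_deriv: "((\<lambda>\<epsilon>. k \<epsilon> t) has_field_derivative k' \<epsilon> t) (at \<epsilon> within J)"
    if "\<epsilon> \<in> J" "t \<in> {t0..tf}" for \<epsilon> t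
  proof -
    have line: "((\<lambda>\<epsilon>. a + \<epsilon> *\<^sub>R b) has_vector_derivative b) (at \<epsilon>)" for a b :: "'v::real_normed_vector"
      by (auto intro!: derivative_eq_intros)
    have "((\<lambda>\<epsilon>. H (x t + \<epsilon> *\<^sub>R dx t)) has_derivative (\<lambda>h. (h *\<^sub>R dx t) \<bullet> G (x t + \<epsilon> *\<^sub>R dx t))) (at \<epsilon>)"
      using H[OF J[OF that]] line[of "x t" "dx t"]
      unfolding gderiv_def has_vector_derivative_def by (rule has_derivative_compose[rotated])
    then have "((\<lambda>\<epsilon>. H (x t + \<epsilon> *\<^sub>R dx t)) has_vector_derivative dx t \<bullet> G (x t + \<epsilon> *\<^sub>R dx t)) (at \<epsilon>)"
      by (simp add: has_vector_derivative_def)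
    moreover have "((\<lambda>\<epsilon>. (p t + \<epsilon> *\<^sub>R dp t) \<bullet> ((q t + \<epsilon> *\<^sub>R dq t) \<times>\<^sub>n (q' t + \<epsilon> *\<^sub>R dq' t)))
        has_vector_derivative
          (p t + \<epsilon> *\<^sub>R dp t) \<bullet> ((q t + \<epsilon> *\<^sub>R dq t) \<times>\<^sub>n dq' t + dq t \<times>\<^sub>n (q' t + \<epsilon> *\<^sub>R dq' t))
          + dp t \<bullet> ((q t + \<epsilon> *\<^sub>R dq t) \<times>\<^sub>n (q' t + \<epsilon> *\<^sub>R dq' t))) (at \<epsilon>)"
      by (intro bounded_bilinear.has_vector_derivative[OF bounded_bilinear_inner]
          has_vector_derivative_vcross line)
    ultimately have "((\<lambda>\<epsilon>. k \<epsilon> t) has_vector_derivative k' \<epsilon> t) (at \<epsilon>)"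
      unfolding k_def k'_def
      by (auto intro!: derivative_eq_intros simp: add.commute)
    then show ?thesis
      by (simp add: has_real_derivative_iff_has_vector_derivative has_vector_derivative_at_within)
  qed
  have "((\<lambda>\<epsilon>. integral (cbox t0 tf) (k \<epsilon>)) has_field_derivative integral (cbox t0 tf) (k' 0))
      (at 0 within J)"
  proof (rule leibniz_rule_field_derivative)
    show "((\<lambda>\<epsilon>. k \<epsilon> t) has_field_derivative k' \<epsilon> t) (at \<epsilon> within J)"
      if "\<epsilon> \<in> J" "t \<in> cbox t0 tf" for \<epsilon> t
      using k_deriv that by simp
    show "k \<epsilon> integrable_on cbox t0 tf" if "\<epsilon> \<in> J" for \<epsilon>
    proof -
      have "continuous_on U H"
        using H unfolding gderiv_def
        by (intro continuous_at_imp_continuous_on ballI has_derivative_continuous)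
      then have "continuous_on {t0..tf} (\<lambda>t. H (x t + \<epsilon> *\<^sub>R dx t))"
        by (rule continuous_on_compose2) (use J that in \<open>auto intro!: continuous_intros contx\<close>)
      then have "continuous_on {t0..tf} (k \<epsilon>)"
        unfolding k_def[abs_def] by (intro continuous_intros cont contq)
      then show ?thesis
        by (simp add: integrable_continuous_interval)
    qed
    have snd_cont: "continuous_on (Sigma J (\<lambda>_. {t0..tf})) (\<lambda>z. h (snd z))"
      if "continuous_on {t0..tf} h" for h :: "real \<Rightarrow> 'v::topological_space"
      by (rule continuous_on_compose2[OF that]) (auto intro!: continuous_intros)
    have "continuous_on (Sigma J (\<lambda>_. {t0..tf})) (\<lambda>z. G (x (snd z) + fst z *\<^sub>R dx (snd z)))"
      by (rule continuous_on_compose2[OF G])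
        (use J in \<open>auto intro!: continuous_intros snd_cont contx\<close>)
    then have "continuous_on (Sigma J (\<lambda>_. {t0..tf})) (\<lambda>z. k' (fst z) (snd z))"
      unfolding k'_def by (intro continuous_intros snd_cont cont contq contx)
    then show "continuous_on (Sigma J (\<lambda>_. cbox t0 tf)) (\<lambda>(\<epsilon>, t). k' \<epsilon> t)"
      by (simp add: case_prod_unfold)
  qed (use \<open>e > 0\<close> in \<open>auto simp: J_def\<close>)
  moreover have "at 0 within J = at (0::real)"
    using \<open>e > 0\<close> by (intro at_within_open) (auto simp: J_def)
  ultimately show ?thesis
    unfolding has_first_variation_def action
    by (simp add: k'_def[abs_def] x_def dx_def add.commute)
qed

section \<open>Hamilton's principle for a curve\<close>

locale phase_curve =
  fixes H :: "(real^3^'n) \<times> (real^3^'n) \<Rightarrow> real"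
    and G :: "(real^3^'n) \<times> (real^3^'n) \<Rightarrow> (real^3^'n) \<times> (real^3^'n)"
    and U :: "((real^3^'n) \<times> (real^3^'n)) set"
    and f q q' p p' :: "real \<Rightarrow> real^3^'n"
    and t0 tf :: real
  assumes interval: "t0 < tf"
    and open_U: "open U" and TS2_subset: "TS2 \<subseteq> U"
    and continuous_G: "continuous_on U G"
    and gderiv_H: "\<And>x. x \<in> U \<Longrightarrow> GDERIV H x :> G x"
    and q_deriv: "\<And>t. t \<in> {t0..tf} \<Longrightarrow> (q has_vector_derivative q' t) (at t within {t0..tf})"
    and p_deriv: "\<And>t. t \<in> {t0..tf} \<Longrightarrow> (p has_vector_derivative p' t) (at t within {t0..tf})"
    and continuous_deriv: "continuous_on {t0..tf} q'" "continuous_on {t0..tf} p'"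
    and continuous_f: "continuous_on {t0..tf} f"
    and in_TS2: "\<And>t. t \<in> {t0..tf} \<Longrightarrow> (q t, p t) \<in> TS2"
begin

definition "gradq t = fst (G (q t, p t))"

definition "gradp t = snd (G (q t, p t))"

definition "q_defect t = q' t + q t \<times>\<^sub>n gradp t"

definition "p_defect t =
  p' t - (- (q t \<times>\<^sub>n gradq t) + gradp t \<times>\<^sub>n p t + q t \<times>\<^sub>n f t)"

lemma unit_q: "t \<in> {t0..tf} \<Longrightarrow> norm (q t $ i) = 1"
  and p_perp_q: "t \<in> {t0..tf} \<Longrightarrow> p t $ i \<bullet> q t $ i = 0"
  using in_TS2[of t] by (auto simp: TS2_def config_def tangent_def)

lemma continuous_curves: "continuous_on {t0..tf} q" "continuous_on {t0..tf} p"
  using q_deriv p_deriv by (meson continuous_on_vector_derivative)+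

lemma continuous_grads: "continuous_on {t0..tf} gradq" "continuous_on {t0..tf} gradp"
proof -
  have "continuous_on {t0..tf} (\<lambda>t. G (q t, p t))"
    by (rule continuous_on_compose2[OF continuous_G])
      (use in_TS2 TS2_subset in \<open>auto intro!: continuous_intros continuous_curves\<close>)
  then show "continuous_on {t0..tf} gradq" "continuous_on {t0..tf} gradp"
    unfolding gradq_def gradp_def by (intro continuous_intros; simp)+
qed

lemmas continuous_data = continuous_curves continuous_grads continuous_deriv continuous_f

lemma continuous_defects: "continuous_on {t0..tf} q_defect" "continuous_on {t0..tf} p_defect"
  unfolding q_defect_def p_defect_def by (intro continuous_intros continuous_data)+

lemma component_deriv:
  assumes "t \<in> {t0..tf}"
  shows "((\<lambda>s. q s $ i) has_vector_derivative q' t $ i) (at t within {t0..tf})"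
    and "((\<lambda>s. p s $ i) has_vector_derivative p' t $ i) (at t within {t0..tf})"
  using q_deriv[OF assms] p_deriv[OF assms]
  by (auto intro: bounded_linear.has_vector_derivative[OF bounded_linear_vec_nth])

lemma deriv_perp:
  assumes t: "t \<in> {t0..tf}"
  shows "q t $ i \<bullet> q' t $ i = 0" and "p' t $ i \<bullet> q t $ i + p t $ i \<bullet> q' t $ i = 0"
proof -
  have *: "d = 0" if "((\<lambda>s. u s \<bullet> v s) has_vector_derivative d) (at t within {t0..tf})"
    and "\<And>s. s \<in> {t0..tf} \<Longrightarrow> u s \<bullet> v s = c" for u v :: "real \<Rightarrow> real^3" and c d
  proof -
    have "((\<lambda>s. c) has_vector_derivative d) (at t within {t0..tf})"
      by (rule has_vector_derivative_transform[OF t _ that(1)]) (simp add: that(2))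
    then show "d = 0"
      using t interval by (intro vector_derivative_unique_within[where f = "\<lambda>s. c"])
        (auto simp: trivial_limit_within islimpt_Icc)
  qed
  note inner = bounded_bilinear.has_vector_derivative[OF bounded_bilinear_inner]
  show "q t $ i \<bullet> q' t $ i = 0"
    using *[OF inner[OF component_deriv(1)[OF t] component_deriv(1)[OF t]], of i i 1] unit_q
    by (simp add: dot_square_norm inner_commute)
  show "p' t $ i \<bullet> q t $ i + p t $ i \<bullet> q' t $ i = 0"
    using *[OF inner[OF component_deriv(2)[OF t] component_deriv(1)[OF t]], of i i 0] p_perp_q
    by simp
qed

lemma eq_0_if_perp_if_cross_eq_0:
  assumes t: "t \<in> {t0..tf}" and v: "\<And>i. q t $ i \<bullet> v $ i = 0" "q t \<times>\<^sub>n v = 0"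
  shows "v = 0"
proof -
  have "v $ i = 0" for i
  proof -
    have "q t $ i \<times> v $ i = 0"
      using v(2) by (metis vcross_nth zero_index)
    then have "q t $ i = 0 \<or> v $ i = 0"
      using v(1) norm_and_cross_eq_0 by blast
    then show ?thesis
      using unit_q[OF t, of i] by auto
  qed
  then show ?thesis
    by (simp add: vec_eq_iff)
qed

lemma q_defect_perp: "t \<in> {t0..tf} \<Longrightarrow> q t $ i \<bullet> q_defect t $ i = 0"
  by (simp add: q_defect_def inner_add_right deriv_perp dot_cross_self)

text \<open>
  Differentiating \<open>p \<bullet> q = 0\<close> gives \<open>p' \<bullet> q = - p \<bullet> q'\<close>.  By the first Hamilton equation this is
  \<open>p \<bullet> (q \<times> gradp) = q \<bullet> (gradp \<times> p)\<close>, the normal component of the right-hand side of the second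
  equation, whose other terms are cross products with \<open>q\<close>.
\<close>

lemma p_defect_perp:
  assumes t: "t \<in> {t0..tf}" and "q_defect t = 0"
  shows "q t $ i \<bullet> p_defect t $ i = 0"
proof -
  have "q_defect t $ i = 0"
    using assms by simp
  then have "q' t $ i = - (q t $ i \<times> gradp t $ i)"
    by (simp add: q_defect_def eq_neg_iff_add_eq_0)
  then have "p' t $ i \<bullet> q t $ i = p t $ i \<bullet> (q t $ i \<times> gradp t $ i)"
    using deriv_perp(2)[OF t, of i] by (simp add: algebra_simps)
  moreover have "p t $ i \<bullet> (q t $ i \<times> gradp t $ i) = q t $ i \<bullet> (gradp t $ i \<times> p t $ i)"
    by (simp add: cross3_simps)
  ultimately show ?thesis
    by (simp add: p_defect_def inner_simps inner_commute dot_cross_self)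
qed

text \<open>
  Integration of \<open>variation_density\<close>: the total derivative of \<open>p \<bullet> \<gamma>\<close> contributes nothing,
  because \<open>\<gamma>\<close> vanishes at both ends.
\<close>

lemma first_variation_eq_defects:
  assumes \<gamma>: "\<And>t. t \<in> {t0..tf} \<Longrightarrow> (\<gamma> has_vector_derivative \<gamma>' t) (at t within {t0..tf})"
    and cont: "continuous_on {t0..tf} \<gamma>'" "continuous_on {t0..tf} dp"
    and ends: "\<gamma> t0 = 0" "\<gamma> tf = 0"
    and dq: "\<And>t. t \<in> {t0..tf} \<Longrightarrow> dq t = \<gamma> t \<times>\<^sub>n q t"
    and dp: "\<And>t i. t \<in> {t0..tf} \<Longrightarrow> dq t $ i \<bullet> p t $ i + q t $ i \<bullet> dp t $ i = 0"
  shows "has_first_variation H t0 tf q p dq dp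
    (integral {t0..tf} (\<lambda>t. (q t \<times>\<^sub>n q_defect t) \<bullet> (dp t + p t \<times>\<^sub>n \<gamma> t) - p_defect t \<bullet> \<gamma> t)
      - virtual_work t0 tf f dq)"
proof -
  define R where
    "R t = (q t \<times>\<^sub>n q_defect t) \<bullet> (dp t + p t \<times>\<^sub>n \<gamma> t) - p_defect t \<bullet> \<gamma> t" for t
  define dq' where "dq' t = \<gamma>' t \<times>\<^sub>n q t + \<gamma> t \<times>\<^sub>n q' t" for t
  have cont_\<gamma>: "continuous_on {t0..tf} \<gamma>"
    using \<gamma> by (meson continuous_on_vector_derivative)
  have cont_dq: "continuous_on {t0..tf} dq"
  proof -
    have "continuous_on {t0..tf} (\<lambda>t. \<gamma> t \<times>\<^sub>n q t)"
      by (intro continuous_intros cont_\<gamma> continuous_data)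
    then show ?thesis
      by (rule continuous_on_eq) (simp add: dq)
  qed
  have dq': "(dq has_vector_derivative dq' t) (at t within {t0..tf})" if t: "t \<in> {t0..tf}" for t
  proof (rule has_vector_derivative_transform[OF t])
    show "((\<lambda>t. \<gamma> t \<times>\<^sub>n q t) has_vector_derivative dq' t) (at t within {t0..tf})"
      using has_vector_derivative_vcross[OF \<gamma>[OF t] q_deriv[OF t]]
      by (simp add: dq'_def add.commute)
  qed (rule dq)
  have cont_dq': "continuous_on {t0..tf} dq'"
    unfolding dq'_def by (intro continuous_intros cont cont_\<gamma> continuous_data)
  define D where "D t = dp t \<bullet> (q t \<times>\<^sub>n q' t) + p t \<bullet> (dq t \<times>\<^sub>n q' t + q t \<times>\<^sub>n dq' t)
       - (dq t, dp t) \<bullet> G (q t, p t)" for t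
  have "has_first_variation H t0 tf q p dq dp (integral {t0..tf} D)"
    unfolding D_def
    using in_TS2 TS2_subset
    by (intro action_has_first_variation[OF interval open_U continuous_G gderiv_H q_deriv dq']
        continuous_deriv continuous_curves cont cont_dq') auto
  moreover have "integral {t0..tf} D = integral {t0..tf} R - virtual_work t0 tf f dq"
  proof -
    have D: "D t = (p t \<bullet> \<gamma>' t + p' t \<bullet> \<gamma> t) + R t - f t \<bullet> dq t" if t: "t \<in> {t0..tf}" for t
      using variation_density[OF in_TS2[OF t], of "\<gamma> t" "dp t" "q' t" "\<gamma>' t"
          "gradq t" "gradp t" "p' t" "f t"] dp[OF t]
      by (simp add: D_def R_def dq[OF t] dq'_def inner_prod_def q_defect_def p_defect_def
          flip: gradq_def gradp_def)
    have "((\<lambda>t. p t \<bullet> \<gamma>' t + p' t \<bullet> \<gamma> t) has_integral p tf \<bullet> \<gamma> tf - p t0 \<bullet> \<gamma> t0) {t0..tf}"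
      using interval
      by (intro fundamental_theorem_of_calculus
          bounded_bilinear.has_vector_derivative[OF bounded_bilinear_inner] p_deriv \<gamma>) auto
    moreover have "continuous_on {t0..tf} R" "continuous_on {t0..tf} (\<lambda>t. f t \<bullet> dq t)"
      unfolding R_def
      by (intro continuous_intros cont_\<gamma> cont_dq cont continuous_defects continuous_data)+
    then have "(R has_integral integral {t0..tf} R) {t0..tf}"
      "((\<lambda>t. f t \<bullet> dq t) has_integral integral {t0..tf} (\<lambda>t. f t \<bullet> dq t)) {t0..tf}"
      by (auto intro!: integrable_integral integrable_continuous_interval)
    ultimately have "((\<lambda>t. (p t \<bullet> \<gamma>' t + p' t \<bullet> \<gamma> t) + R t - f t \<bullet> dq t) has_integral
        (p tf \<bullet> \<gamma> tf - p t0 \<bullet> \<gamma> t0) + integral {t0..tf} R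
          - integral {t0..tf} (\<lambda>t. f t \<bullet> dq t)) {t0..tf}"
      by (intro has_integral_diff has_integral_add)
    then have "(D has_integral integral {t0..tf} R - virtual_work t0 tf f dq) {t0..tf}"
      by (rule has_integral_eq[rotated, THEN has_integral_eq_rhs])
        (simp_all add: D ends virtual_work_def inner_vec_def)
    then show ?thesis
      by (rule integral_unique)
  qed
  ultimately show ?thesis
    unfolding R_def by simp
qed

lemma principle_imp_integral_zero:
  assumes "hamilton_principle H f t0 tf q p"
    and \<gamma>: "\<And>t. t \<in> {t0..tf} \<Longrightarrow> (\<gamma> has_vector_derivative \<gamma>' t) (at t within {t0..tf})"
    and cont: "continuous_on {t0..tf} \<gamma>'" "continuous_on {t0..tf} dp"
    and ends: "\<gamma> t0 = 0" "\<gamma> tf = 0"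
    and perp: "\<And>t i. t \<in> {t0..tf} \<Longrightarrow> \<gamma> t $ i \<bullet> q t $ i = 0"
    and dp: "\<And>t i. t \<in> {t0..tf} \<Longrightarrow> (\<gamma> t $ i \<times> q t $ i) \<bullet> p t $ i + q t $ i \<bullet> dp t $ i = 0"
  shows "integral {t0..tf}
    (\<lambda>t. (q t \<times>\<^sub>n q_defect t) \<bullet> (dp t + p t \<times>\<^sub>n \<gamma> t) - p_defect t \<bullet> \<gamma> t) = 0"
    (is "?I = 0")
proof -
  define dq where "dq t = \<gamma> t \<times>\<^sub>n q t" for t
  have "C1_curve t0 tf \<gamma>"
    using \<gamma> cont by (auto simp: C1_curve_def)
  then have "admissible_variation t0 tf q p dq dp"
    unfolding admissible_variation_def
    using cont ends perp dp by (auto simp: dq_def)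
  then have "has_first_variation H t0 tf q p dq dp (- virtual_work t0 tf f dq)"
    using assms(1) by (auto simp: hamilton_principle_def)
  moreover have "has_first_variation H t0 tf q p dq dp (?I - virtual_work t0 tf f dq)"
    by (rule first_variation_eq_defects[OF \<gamma> cont ends]) (use dp in \<open>auto simp: dq_def\<close>)
  ultimately have "- virtual_work t0 tf f dq = ?I - virtual_work t0 tf f dq"
    unfolding has_first_variation_def by (rule DERIV_unique)
  then show ?thesis
    by simp
qed

text \<open>
  The momentum variation has to be continuous but satisfies no boundary conditions, so for
  \<open>\<gamma> = 0\<close> it may be chosen equal to its own tangential coefficient \<open>q \<times> q_defect\<close>,
  which turns the integrand into a square.
\<close>

lemma principle_imp_q_defect_zero:
  assumes "hamilton_principle H f t0 tf q p" and t: "t \<in> {t0..tf}"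
  shows "q_defect t = 0"
proof -
  define a where "a t = q t \<times>\<^sub>n q_defect t" for t
  have a_cont: "continuous_on {t0..tf} a"
    unfolding a_def by (intro continuous_intros continuous_data continuous_defects)
  have "integral {t0..tf} (\<lambda>t. a t \<bullet> a t) = 0"
    using principle_imp_integral_zero[OF assms(1), of "\<lambda>_. 0" "\<lambda>_. 0" a] a_cont
    by (simp add: a_def dot_cross_self)
  moreover have "continuous_on {t0..tf} (\<lambda>t. a t \<bullet> a t)"
    by (intro continuous_intros a_cont)
  ultimately have "a t \<bullet> a t = 0"
    using t interval by (subst (asm) integral_eq_0_iff) auto
  then have "a t = 0"
    by simp
  then show ?thesis
    by (auto simp: a_def intro: eq_0_if_perp_if_cross_eq_0[OF t] q_defect_perp[OF t])
qed

text \<open>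
  The defect is merely continuous, so it cannot be used to build the \<open>C\<^sup>1\<close> variation \<open>\<gamma>\<close>.  Instead
  \<open>\<gamma> = \<phi> (q \<times> c)\<close> is used, with a scalar test function \<open>\<phi>\<close> and a constant vector \<open>c\<close>: it is
  tangential by construction and as smooth as \<open>q\<close> and \<open>\<phi>\<close>.  This tests every coordinate of
  \<open>q \<times> p_defect\<close>.
\<close>

lemma principle_imp_p_defect_zero:
  assumes principle: "hamilton_principle H f t0 tf q p" and t: "t \<in> {t0..tf}"
  shows "p_defect t = 0"
proof -
  have "c \<bullet> (q t \<times>\<^sub>n p_defect t) = 0" for c :: "real^3^'n"
  proof (rule fundamental_lemma_calculus_of_variations[OF interval _ _ t])
    show "continuous_on {t0..tf} (\<lambda>t. c \<bullet> (q t \<times>\<^sub>n p_defect t))"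
      by (intro continuous_intros continuous_data continuous_defects)
    fix \<phi> \<phi>' :: "real \<Rightarrow> real"
    assume \<phi>: "\<And>t. (\<phi> has_real_derivative \<phi>' t) (at t)" "continuous_on UNIV \<phi>'"
      and ends: "\<phi> t0 = 0" "\<phi> tf = 0"
    define \<gamma> where "\<gamma> t = \<phi> t *\<^sub>R (q t \<times>\<^sub>n c)" for t
    define \<gamma>' where "\<gamma>' t = \<phi> t *\<^sub>R (q' t \<times>\<^sub>n c) + \<phi>' t *\<^sub>R (q t \<times>\<^sub>n c)" for t
    \<comment> \<open>The multiple of \<open>q\<close> forced by the linearized constraint \<open>\<delta>q \<bullet> p + q \<bullet> \<delta>\<pi> = 0\<close>.\<close>
    define dp where "dp t = (\<chi> i. - ((\<gamma> t $ i \<times> q t $ i) \<bullet> p t $ i) *\<^sub>R q t $ i)" for t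
    have \<phi>_cont: "continuous_on {t0..tf} \<phi>" "continuous_on {t0..tf} \<phi>'"
      using \<phi> by (auto intro: DERIV_continuous_on DERIV_subset continuous_on_subset)
    have "integral {t0..tf}
       (\<lambda>t. (q t \<times>\<^sub>n q_defect t) \<bullet> (dp t + p t \<times>\<^sub>n \<gamma> t) - p_defect t \<bullet> \<gamma> t) = 0"
    proof (rule principle_imp_integral_zero[OF principle])
      show "(\<gamma> has_vector_derivative \<gamma>' s) (at s within {t0..tf})" if s: "s \<in> {t0..tf}" for s
      proof -
        have "((\<lambda>t. q t \<times>\<^sub>n c) has_vector_derivative q' s \<times>\<^sub>n c) (at s within {t0..tf})"
          using has_vector_derivative_vcross[OF q_deriv[OF s] has_vector_derivative_const[of c]]
          by simp
        then show ?thesis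
          unfolding \<gamma>_def \<gamma>'_def
          by (intro has_vector_derivative_scaleR DERIV_subset[OF \<phi>(1)]) auto
      qed
      show "continuous_on {t0..tf} \<gamma>'"
        unfolding \<gamma>'_def by (intro continuous_intros \<phi>_cont continuous_data)
      show "continuous_on {t0..tf} dp"
        unfolding dp_def \<gamma>_def
        by (intro continuous_intros continuous_on_cross \<phi>_cont continuous_data)
      show "\<gamma> s $ i \<bullet> q s $ i = 0" for s i
        by (simp add: \<gamma>_def dot_cross_self)
      show "(\<gamma> s $ i \<times> q s $ i) \<bullet> p s $ i + q s $ i \<bullet> dp s $ i = 0" if "s \<in> {t0..tf}" for s i
        using unit_q[OF that] by (simp add: dp_def dot_square_norm)
    qed (simp_all add: \<gamma>_def ends)
    moreover have "(q s \<times>\<^sub>n q_defect s) \<bullet> (dp s + p s \<times>\<^sub>n \<gamma> s) - p_defect s \<bullet> \<gamma> s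
        = \<phi> s * (c \<bullet> (q s \<times>\<^sub>n p_defect s))" if s: "s \<in> {t0..tf}" for s
    proof -
      have "a \<bullet> (b \<times> d) = - (d \<bullet> (b \<times> a))" for a b d :: "real^3"
        by (simp add: cross3_simps)
      then have "p_defect s \<bullet> (q s \<times>\<^sub>n c) = - (c \<bullet> (q s \<times>\<^sub>n p_defect s))"
        unfolding inner_eq_sum_components vcross_nth sum_negf[symmetric]
        by (intro sum.cong refl)
      then show ?thesis
        by (simp add: principle_imp_q_defect_zero[OF principle s] \<gamma>_def)
    qed
    ultimately show "integral {t0..tf} (\<lambda>t. \<phi> t * (c \<bullet> (q t \<times>\<^sub>n p_defect t))) = 0"
      using integral_cong by (smt (verit, best))
  qed
  then have "q t \<times>\<^sub>n p_defect t = 0"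
    using inner_eq_zero_iff by blast
  with p_defect_perp[OF t principle_imp_q_defect_zero[OF principle t]] show ?thesis
    by (rule eq_0_if_perp_if_cross_eq_0[OF t])
qed

lemma hamilton_principle_iff_defects_zero:
  "hamilton_principle H f t0 tf q p \<longleftrightarrow>
    (\<forall>t\<in>{t0..tf}. q_defect t = 0 \<and> p_defect t = 0)" (is "_ \<longleftrightarrow> ?zero")
proof
  assume zero: ?zero
  show "hamilton_principle H f t0 tf q p"
    unfolding hamilton_principle_def
  proof (intro allI impI)
    fix dq dp assume adm: "admissible_variation t0 tf q p dq dp"
    then obtain \<gamma> \<gamma>' where
      \<gamma>: "\<And>t. t \<in> {t0..tf} \<Longrightarrow> (\<gamma> has_vector_derivative \<gamma>' t) (at t within {t0..tf})"
      and cont: "continuous_on {t0..tf} \<gamma>'" "continuous_on {t0..tf} dp"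
      and ends: "\<gamma> t0 = 0" "\<gamma> tf = 0"
      and dq: "\<And>t i. t \<in> {t0..tf} \<Longrightarrow> dq t $ i = \<gamma> t $ i \<times> q t $ i"
      and dp: "\<And>t i. t \<in> {t0..tf} \<Longrightarrow> dq t $ i \<bullet> p t $ i + q t $ i \<bullet> dp t $ i = 0"
      unfolding admissible_variation_def C1_curve_def by blast
    have "dq t = \<gamma> t \<times>\<^sub>n q t" if "t \<in> {t0..tf}" for t
      using dq[OF that] by (simp add: vec_eq_iff)
    note variation = first_variation_eq_defects[OF \<gamma> cont ends this dp]
    have "integral {t0..tf} (\<lambda>t. (q t \<times>\<^sub>n q_defect t) \<bullet> (dp t + p t \<times>\<^sub>n \<gamma> t) - p_defect t \<bullet> \<gamma> t)
        = integral {t0..tf} (\<lambda>t. 0)"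
      using zero by (intro integral_cong) simp
    with variation show "has_first_variation H t0 tf q p dq dp (- virtual_work t0 tf f dq)"
      by simp
  qed
qed (simp add: principle_imp_q_defect_zero principle_imp_p_defect_zero)

lemma defects_zero_iff_hamilton_equations:
  assumes t: "t \<in> {t0..tf}"
  shows "q_defect t = 0 \<and> p_defect t = 0 \<longleftrightarrow>
    (\<forall>i. ((\<lambda>s. q s $ i) has_vector_derivative
          - (q t $ i \<times> grad2 H (q t) (p t) $ i)) (at t within {t0..tf}) \<and>
       ((\<lambda>s. p s $ i) has_vector_derivative
          - (q t $ i \<times> grad1 H (q t) (p t) $ i)
          + grad2 H (q t) (p t) $ i \<times> p t $ i
          + q t $ i \<times> f t $ i) (at t within {t0..tf}))"
proof -
  have "at t within {t0..tf} \<noteq> bot"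
    using t interval by (simp add: trivial_limit_within islimpt_Icc)
  then have unique: "(x has_vector_derivative v) (at t within {t0..tf}) \<longleftrightarrow> x' = v"
    if "(x has_vector_derivative x') (at t within {t0..tf})" for x :: "real \<Rightarrow> real^3" and x' v
    using that vector_derivative_unique_within by blast
  have "GDERIV H (q t, p t) :> G (q t, p t)"
    using in_TS2[OF t] TS2_subset by (intro gderiv_H) auto
  note grad = GDERIV_imp_grad[OF this, folded gradq_def gradp_def]
  show ?thesis
    unfolding grad unique[OF component_deriv(1)[OF t]] unique[OF component_deriv(2)[OF t]]
    by (auto simp: vec_eq_iff[where 'b = 'n] q_defect_def p_defect_def eq_neg_iff_add_eq_0)
qed

end

theorem proposition4:
  fixes L Lt Ht :: "(real^3^'n) \<times> (real^3^'n) \<Rightarrow> real"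
    and q \<pi> f :: "real \<Rightarrow> real^3^'n"
    and t0 tf :: real
  assumes Lt_smooth: "C1_near TS2 Lt"
    and Lt_eq: "\<And>x \<omega>. (x, \<omega>) \<in> TS2 \<Longrightarrow> Lt (x, \<omega>) = L (x, \<chi> i. \<omega> $ i \<times> x $ i)"
    and legendre_invertible:
      "\<And>x. x \<in> config \<Longrightarrow> bij_betw (legendre Lt x) (tangent x) (tangent x)"
    and Ht_smooth: "C1_near TS2 Ht"
    and Ht_eq: "\<And>x p. (x, p) \<in> TS2 \<Longrightarrow> Ht (x, p) = hamiltonian Lt x p"
    and interval: "t0 < tf"
    and curve_smooth: "C1_curve t0 tf q" "C1_curve t0 tf \<pi>"
    and curve_in: "\<And>t. t \<in> {t0..tf} \<Longrightarrow> (q t, \<pi> t) \<in> TS2"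
    and force_continuous: "continuous_on {t0..tf} f"
  shows "hamilton_principle Ht f t0 tf q \<pi> \<longleftrightarrow>
    (\<forall>t\<in>{t0..tf}. \<forall>i.
       ((\<lambda>s. q s $ i) has_vector_derivative
          - (q t $ i \<times> grad2 Ht (q t) (\<pi> t) $ i)) (at t within {t0..tf}) \<and>
       ((\<lambda>s. \<pi> s $ i) has_vector_derivative
          - (q t $ i \<times> grad1 Ht (q t) (\<pi> t) $ i)
          + grad2 Ht (q t) (\<pi> t) $ i \<times> \<pi> t $ i
          + q t $ i \<times> f t $ i) (at t within {t0..tf}))"
proof -
  obtain U G where "open U" "TS2 \<subseteq> U" "continuous_on U G" "\<And>x. x \<in> U \<Longrightarrow> GDERIV Ht x :> G x"
    using Ht_smooth by (auto simp: C1_near_def)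
  moreover obtain q' where "continuous_on {t0..tf} q'"
    "\<And>t. t \<in> {t0..tf} \<Longrightarrow> (q has_vector_derivative q' t) (at t within {t0..tf})"
    using curve_smooth(1) by (auto simp: C1_curve_def)
  moreover obtain \<pi>' where "continuous_on {t0..tf} \<pi>'"
    "\<And>t. t \<in> {t0..tf} \<Longrightarrow> (\<pi> has_vector_derivative \<pi>' t) (at t within {t0..tf})"
    using curve_smooth(2) by (auto simp: C1_curve_def)
  ultimately interpret phase_curve Ht G U f q q' \<pi> \<pi>' t0 tf
    using interval curve_in force_continuous by unfold_locales auto
  show ?thesis
    by (simp add: hamilton_principle_iff_defects_zero defects_zero_iff_hamilton_equations)
qed

end
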